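(* The equation $$F(x)=\frac{l\sqrt{\pi}}{D_\infty c_1}\,G(x),\qquad x>0,$$ has exactly one positive solution if and only if $h_0>h_0^\star$, where $$h_0^\star=\frac{\gamma k_1}{2D_\infty\,\eta\,\sqrt{\alpha_2}}$$ and $\eta=\eta\left(\frac{\gamma k_1}{\theta_0k_2},\frac{(1-\epsilon)l}{\theta_0c_2}\right)$ is the only solution of the equation $F_3(x)=0$, $x>0$, with $$F_3(x)=\frac{e^{-x^2}}{\operatorname{erfc}(x)}-\frac{\gamma k_1\sqrt\pi}{2\theta_0k_2}\frac1x+\frac{(1-\epsilon)l\sqrt\pi}{\theta_0c_2}\,x,\qquad x>0.$$
   Context: Parameters: $\rho,k_1,k_2,c_1,c_2,l,\gamma,\theta_0,D_\infty,h_0>0$ and $0<\epsilon<1$ are real constants; $\alpha_i=\frac{k_i}{\rho c_i}$ for $i=1,2$, and $\alpha_{12}=\frac{\alpha_1}{\alpha_2}$. As usual $\operatorname{erf}(x)=\frac{2}{\sqrt\pi}\int_0^x e^{-y^2}\,dy$ and $\operatorname{erfc}=1-\operatorname{erf}$. Auxiliary functions, for $x>0$: $$W(x)=x+\frac{\gamma\sqrt\pi}{2D_\infty}e^{x^2}\left(\operatorname{erf}(x)+\frac{k_1}{h_0\sqrt{\alpha_1\pi}}\right),$$ $$F(x)=\frac{e^{-x^2}}{\operatorname{erf}(x)+\frac{k_1}{h_0\sqrt{\alpha_1\pi}}}-\frac{\theta_0\sqrt{k_2c_2}}{D_\infty\sqrt{k_1c_1}}\,\frac{\exp\left(-\alpha_{12}W^2(x)\right)}{\operatorname{erfc}\left(\sqrt{\alpha_{12}}W(x)\right)},$$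 $$G(x)=x+\frac{(1-\epsilon)\gamma\sqrt\pi}{2D_\infty}e^{x^2}\left(\operatorname{erf}(x)+\frac{k_1}{h_0\sqrt{\alpha_1\pi}}\right).$$ *)

theory Defs
  imports "HOL-Analysis.Analysis"
begin

(* The interval integral is oriented, so this is the usual odd error function on all reals. *)
definition erf :: "real \<Rightarrow> real" where
  "erf x = 2 / sqrt pi * (LBINT y=ereal 0..ereal x. exp (- (y\<^sup>2)))"

definition erfc :: "real \<Rightarrow> real" where
  "erfc x = 1 - erf x"

definition diffusivity :: "real \<Rightarrow> real \<Rightarrow> real \<Rightarrow> real" where
  "diffusivity \<rho> k c = k / (\<rho> * c)"

(* The term erf x + k1 / (h0 sqrt (alpha1 pi)), which occurs in each of W, F and G. *)
definition erf_shift :: "real \<Rightarrow> real \<Rightarrow> real \<Rightarrow> real \<Rightarrow> real \<Rightarrow> real" where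
  "erf_shift \<rho> k\<^sub>1 c\<^sub>1 h\<^sub>0 x = erf x + k\<^sub>1 / (h\<^sub>0 * sqrt (diffusivity \<rho> k\<^sub>1 c\<^sub>1 * pi))"

definition W_fun :: "real \<Rightarrow> real \<Rightarrow> real \<Rightarrow> real \<Rightarrow> real \<Rightarrow> real \<Rightarrow> real \<Rightarrow> real" where
  "W_fun \<rho> k\<^sub>1 c\<^sub>1 \<gamma> D h\<^sub>0 x =
     x + \<gamma> * sqrt pi / (2 * D) * exp (x\<^sup>2) * erf_shift \<rho> k\<^sub>1 c\<^sub>1 h\<^sub>0 x"

definition G_fun :: "real \<Rightarrow> real \<Rightarrow> real \<Rightarrow> real \<Rightarrow> real \<Rightarrow> real \<Rightarrow> real \<Rightarrow> real \<Rightarrow> real" where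
  "G_fun \<rho> k\<^sub>1 c\<^sub>1 \<gamma> D h\<^sub>0 \<epsilon> x =
     x + (1 - \<epsilon>) * \<gamma> * sqrt pi / (2 * D) * exp (x\<^sup>2) * erf_shift \<rho> k\<^sub>1 c\<^sub>1 h\<^sub>0 x"

definition F_fun ::
    "real \<Rightarrow> real \<Rightarrow> real \<Rightarrow> real \<Rightarrow> real \<Rightarrow> real \<Rightarrow> real \<Rightarrow> real \<Rightarrow> real \<Rightarrow> real \<Rightarrow> real" where
  "F_fun \<rho> k\<^sub>1 k\<^sub>2 c\<^sub>1 c\<^sub>2 \<gamma> \<theta>\<^sub>0 D h\<^sub>0 x =
     (let \<alpha>\<^sub>1\<^sub>2 = diffusivity \<rho> k\<^sub>1 c\<^sub>1 / diffusivity \<rho> k\<^sub>2 c\<^sub>2;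
          w = W_fun \<rho> k\<^sub>1 c\<^sub>1 \<gamma> D h\<^sub>0 x
      in exp (- (x\<^sup>2)) / erf_shift \<rho> k\<^sub>1 c\<^sub>1 h\<^sub>0 x
         - \<theta>\<^sub>0 * sqrt (k\<^sub>2 * c\<^sub>2) / (D * sqrt (k\<^sub>1 * c\<^sub>1))
           * (exp (- \<alpha>\<^sub>1\<^sub>2 * w\<^sup>2) / erfc (sqrt \<alpha>\<^sub>1\<^sub>2 * w)))"

(* F3 depends on the physical constants only through the two arguments of eta:
   a = gamma k1 / (theta0 k2) and b = (1 - epsilon) l / (theta0 c2). *)
definition F3 :: "real \<Rightarrow> real \<Rightarrow> real \<Rightarrow> real" where
  "F3 a b x = exp (- (x\<^sup>2)) / erfc x - a * sqrt pi / 2 * (1 / x) + b * sqrt pi * x"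

definition eta :: "real \<Rightarrow> real \<Rightarrow> real" where
  "eta a b = (THE x. x > 0 \<and> F3 a b x = 0)"

definition h0_star ::
    "real \<Rightarrow> real \<Rightarrow> real \<Rightarrow> real \<Rightarrow> real \<Rightarrow> real \<Rightarrow> real \<Rightarrow> real \<Rightarrow> real \<Rightarrow> real" where
  "h0_star \<rho> k\<^sub>1 k\<^sub>2 c\<^sub>2 l \<gamma> \<theta>\<^sub>0 D \<epsilon> =
     \<gamma> * k\<^sub>1 / (2 * D * eta (\<gamma> * k\<^sub>1 / (\<theta>\<^sub>0 * k\<^sub>2)) ((1 - \<epsilon>) * l / (\<theta>\<^sub>0 * c\<^sub>2))
                 * sqrt (diffusivity \<rho> k\<^sub>2 c\<^sub>2))"

end

theory Submission
  imports Defs "HOL-Probability.Distributions" "HOL-Real_Asymp.Real_Asymp"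
begin

text \<open>
  The quotient \<open>exp (- x\<^sup>2) / erfc x\<close> is strictly increasing, because
  \<open>erfc x < exp (- x\<^sup>2) / (x * sqrt pi)\<close> for positive \<open>x\<close>. Hence the difference of the two sides of
  the equation is continuous and strictly decreasing on the closed half-line, and negative far out,
  so it has a positive zero (then a single one) iff its value at \<open>0\<close> is positive. That value is a
  negative multiple of \<open>F3\<close> at \<open>\<gamma> k\<^sub>1 / (2 D h\<^sub>0 \<surd>\<alpha>\<^sub>2)\<close>, the image of \<open>W(0)\<close> under scaling
  by \<open>\<surd>\<alpha>\<^sub>1\<^sub>2\<close>, and \<open>F3\<close> is strictly increasing with zero \<open>\<eta>\<close>.
\<close>

section \<open>Error function: derivative, limit at infinity and signs\<close>

lemma erf_0 [simp]: "erf 0 = 0"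
  by (simp add: erf_def zero_ereal_def[symmetric])

lemma has_real_derivative_erf:
  "(erf has_real_derivative 2 / sqrt pi * exp (- x\<^sup>2)) (at x)"
proof -
  \<comment> \<open>The margin of 1 puts \<open>0\<close> and \<open>x\<close> in the interior, so
    the derivative within the interval is two-sided.\<close>
  define a b where "a = min 0 x - 1" and "b = max 0 x + 1"
  have "((\<lambda>u. LBINT y=ereal 0..ereal u. exp (- y\<^sup>2)) has_vector_derivative exp (- x\<^sup>2))
      (at x within {a..b})"
    by (rule interval_integral_FTC2) (auto simp: a_def b_def intro!: continuous_intros)
  moreover have "at x within {a..b} = at x"
    by (rule at_within_Icc_at) (auto simp: a_def b_def)
  ultimately have "((\<lambda>u. LBINT y=ereal 0..ereal u. exp (- y\<^sup>2)) has_real_derivative exp (- x\<^sup>2)) (at x)"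
    by (simp add: has_real_derivative_iff_has_vector_derivative)
  then show ?thesis
    unfolding erf_def[abs_def] by (rule DERIV_cmult)
qed

lemmas DERIV_erf_chain [derivative_intros] = DERIV_chain2[OF has_real_derivative_erf]

text \<open>The half-line Gaussian integral \<open>sqrt pi / 2\<close> cancels the normalising
  factor; the indicator in \<open>?f\<close> turns integrals over \<open>{..u}\<close> into
  integrals over \<open>{0..u}\<close>.\<close>

lemma erf_tendsto_1: "(erf \<longlongrightarrow> 1) at_top"
proof -
  let ?f = "\<lambda>x::real. indicator {0..} x *\<^sub>R exp (- x\<^sup>2)"
  have *: "integrable lborel ?f" "integral\<^sup>L lborel ?f = sqrt pi / 2"
    using gaussian_moment_0 by (auto simp: has_bochner_integral_iff)
  have "((\<lambda>u. LINT x:{..u}|lborel. ?f x) \<longlongrightarrow> sqrt pi / 2) at_top"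
    unfolding set_lebesgue_integral_def *(2)[symmetric]
    by (rule tendsto_integral_at_top) (simp_all only: sets_lborel *(1))
  then have "((\<lambda>u. 2 / sqrt pi * (LINT x:{..u}|lborel. ?f x)) \<longlongrightarrow> 2 / sqrt pi * (sqrt pi / 2)) at_top"
    by (intro tendsto_intros)
  moreover have "eventually (\<lambda>u. 2 / sqrt pi * (LINT x:{..u}|lborel. ?f x) = erf u) at_top"
    using eventually_ge_at_top[of 0]
  proof eventually_elim
    case (elim u)
    have "(LINT x:{..u}|lborel. ?f x) = (LINT x:{0..u}|lborel. exp (- x\<^sup>2))"
      unfolding set_lebesgue_integral_def
      by (intro Bochner_Integration.integral_cong) (auto simp: indicator_def)
    then show ?case
      using elim by (simp add: erf_def interval_integral_Icc)
  qed
  ultimately show ?thesis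
    by (simp add: tendsto_cong)
qed

lemma erfc_tendsto_0: "(erfc \<longlongrightarrow> 0) at_top"
  using tendsto_diff[OF tendsto_const erf_tendsto_1, of 1] by (simp add: erfc_def[abs_def])

lemma has_real_derivative_erfc:
  "(erfc has_real_derivative - (2 / sqrt pi * exp (- x\<^sup>2))) (at x)"
  unfolding erfc_def[abs_def] by (auto intro!: derivative_eq_intros)

lemma continuous_on_erf [continuous_intros]: "continuous_on A erf"
  by (meson DERIV_isCont continuous_at_imp_continuous_on has_real_derivative_erf)

lemma continuous_on_erfc: "continuous_on A erfc"
  unfolding erfc_def[abs_def] by (intro continuous_intros)

lemma erf_strict_mono: "x < y \<Longrightarrow> erf x < erf y"
  by (rule DERIV_pos_imp_increasing[of x y erf]) (auto intro!: exI has_real_derivative_erf)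

lemma erf_nonneg: "0 \<le> x \<Longrightarrow> 0 \<le> erf x"
  using erf_strict_mono[of 0 x] by (cases "x = 0") auto

text \<open>A strictly decreasing function with limit 0 at infinity is positive.\<close>

lemma erfc_pos: "0 < erfc x"
  by (rule DERIV_neg_imp_decreasing_at_top[OF _ erfc_tendsto_0, of x])
     (auto intro!: exI has_real_derivative_erfc)

section \<open>Mills-type bound and the Gaussian quotient\<close>

text \<open>In the derivative of the gap \<open>?g\<close> the \<open>erfc\<close> contribution
  cancels and a negative term is left; a gap that decreases to 0 is positive.\<close>

lemma erfc_less_Mills:
  assumes "0 < x"
  shows "erfc x < exp (- x\<^sup>2) / (x * sqrt pi)"
proof -
  let ?g = "\<lambda>x. exp (- x\<^sup>2) / (x * sqrt pi) - erfc x"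
  have "((\<lambda>x::real. exp (- x\<^sup>2) / (x * sqrt pi)) \<longlongrightarrow> 0) at_top"
    by real_asymp
  from tendsto_diff[OF this erfc_tendsto_0] have lim: "(?g \<longlongrightarrow> 0) at_top"
    by simp
  have "(?g has_real_derivative - (exp (- y\<^sup>2) / (y\<^sup>2 * sqrt pi))) (at y)" if "x \<le> y" for y
  proof -
    have "((\<lambda>x. exp (- x\<^sup>2) / x) has_real_derivative - 2 * exp (- y\<^sup>2) - exp (- y\<^sup>2) / y\<^sup>2) (at y)"
      using that assms by (auto intro!: derivative_eq_intros simp: field_simps power2_eq_square)
    from DERIV_diff[OF DERIV_cdivide[OF this, of "sqrt pi"] has_real_derivative_erfc]
    show ?thesis
      by (simp add: diff_divide_distrib)
  qed
  moreover have "- (exp (- y\<^sup>2) / (y\<^sup>2 * sqrt pi)) < 0" if "x \<le> y" for y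
    using that assms by simp
  ultimately have "0 < ?g x"
    by (intro DERIV_neg_imp_decreasing_at_top[OF _ lim, of x]) blast
  then show ?thesis by simp
qed

text \<open>The derivative has the sign of \<open>exp (- t\<^sup>2) / sqrt pi - t * erfc t\<close>,
  positive by \<open>erfc_less_Mills\<close> for \<open>t > 0\<close>. Derivatives are taken only at
  interior points, so continuity covers the endpoint \<open>x = 0\<close>.\<close>

lemma exp_div_erfc_strict_mono:
  assumes "0 \<le> x" "x < y"
  shows "exp (- x\<^sup>2) / erfc x < exp (- y\<^sup>2) / erfc y"
proof (rule DERIV_pos_imp_increasing_open[OF assms(2)])
  fix t assume t: "x < t" "t < y"
  have "t * erfc t < exp (- t\<^sup>2) / sqrt pi"
    using erfc_less_Mills[of t] t assms by (simp add: field_simps)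
  then have "0 < 2 * exp (- t\<^sup>2) * (exp (- t\<^sup>2) / sqrt pi - t * erfc t) / (erfc t)\<^sup>2"
    using erfc_pos[of t] by simp
  moreover have "((\<lambda>t. exp (- t\<^sup>2) / erfc t) has_real_derivative
      2 * exp (- t\<^sup>2) * (exp (- t\<^sup>2) / sqrt pi - t * erfc t) / (erfc t)\<^sup>2) (at t)"
    using erfc_pos[of t]
    by (auto intro!: derivative_eq_intros has_real_derivative_erfc simp: field_simps power2_eq_square)
  ultimately show "\<exists>d. ((\<lambda>t. exp (- t\<^sup>2) / erfc t) has_real_derivative d) (at t) \<and> 0 < d"
    by blast
next
  show "continuous_on {x..y} (\<lambda>t. exp (- t\<^sup>2) / erfc t)"
    using erfc_pos by (intro continuous_intros continuous_on_erfc) (auto simp: less_imp_neq[symmetric])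
qed

section \<open>The function \<open>F3\<close> and its zero\<close>

lemma F3_strict_mono:
  assumes "0 < a" "0 < b" "0 < x" "x < y"
  shows "F3 a b x < F3 a b y"
proof -
  have "exp (- x\<^sup>2) / erfc x < exp (- y\<^sup>2) / erfc y"
    using assms by (intro exp_div_erfc_strict_mono) auto
  moreover have "a * sqrt pi / 2 * (1 / y) < a * sqrt pi / 2 * (1 / x)"
    using assms by (intro mult_strict_left_mono divide_strict_left_mono) auto
  moreover have "b * sqrt pi * x < b * sqrt pi * y"
    using assms by (intro mult_strict_left_mono) auto
  ultimately show ?thesis
    by (simp add: F3_def)
qed

lemma F3_unique_zero:
  assumes "0 < a" "0 < b"
  shows "\<exists>!x. 0 < x \<and> F3 a b x = 0"
proof -
  \<comment> \<open>\<open>c\<close> bounds the quotient on \<open>{0<..1}\<close>. At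
    \<open>u\<close> the \<open>1 / x\<close> term outweighs \<open>c + b * sqrt pi\<close>; at
    \<open>v\<close>, where \<open>1 / v \<le> 1\<close>, the linear term outweighs the
    \<open>1 / x\<close> term. This gives the sign change.\<close>
  define c where "c = exp (- 1) / erfc 1"
  define u where "u = min 1 (a * sqrt pi / (2 * (c + b * sqrt pi)))"
  define v where "v = max 1 (a / (2 * b))"
  have c: "0 < c"
    by (simp add: c_def erfc_pos)
  have cb: "0 < c + b * sqrt pi"
    using c assms by (simp add: add_pos_pos)
  have u: "0 < u" "u \<le> 1" "u \<le> a * sqrt pi / (2 * (c + b * sqrt pi))"
    using assms cb by (auto simp: u_def)
  have v: "1 \<le> v" "a / (2 * b) \<le> v"
    by (auto simp: v_def)
  have "exp (- u\<^sup>2) / erfc u \<le> c"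
    using exp_div_erfc_strict_mono[of u 1] u by (cases "u = 1") (auto simp: c_def)
  moreover have "b * sqrt pi * u \<le> b * sqrt pi"
    using u assms by (simp add: mult_left_le)
  moreover have "c + b * sqrt pi \<le> a * sqrt pi / 2 * (1 / u)"
    using u cb by (simp add: field_simps)
  ultimately have Fu: "F3 a b u \<le> 0"
    by (simp add: F3_def)
  have "a * sqrt pi / 2 * (1 / v) \<le> a * sqrt pi / 2 * 1"
    using v assms by (intro mult_left_mono) auto
  moreover have "a * sqrt pi / 2 \<le> b * sqrt pi * v"
    using v(2) assms by (simp add: field_simps)
  moreover have "0 < exp (- v\<^sup>2) / erfc v"
    by (simp add: erfc_pos)
  ultimately have Fv: "0 \<le> F3 a b v"
    unfolding F3_def by linarith
  have "continuous_on {u..v} (F3 a b)"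
    unfolding F3_def[abs_def] using u erfc_pos
    by (intro continuous_intros continuous_on_erfc) (auto simp: less_imp_neq[symmetric])
  then obtain x where "u \<le> x" "F3 a b x = 0"
    using IVT'[of "F3 a b" u 0 v] Fu Fv u v by auto
  then have "0 < x \<and> F3 a b x = 0"
    using u by simp
  moreover have "x = y" if "0 < x \<and> F3 a b x = 0" "0 < y \<and> F3 a b y = 0" for x y
    using that F3_strict_mono[OF assms, of x y] F3_strict_mono[OF assms, of y x]
    by (cases x y rule: linorder_cases) auto
  ultimately show ?thesis
    by blast
qed

lemma F3_neg_iff_less_eta:
  assumes "0 < a" "0 < b" "0 < x"
  shows "F3 a b x < 0 \<longleftrightarrow> x < eta a b"
proof -
  have *: "0 < eta a b \<and> F3 a b (eta a b) = 0"
    unfolding eta_def by (rule theI'[OF F3_unique_zero[OF assms(1,2)]])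
  then show ?thesis
    using F3_strict_mono[OF assms(1,2), of x "eta a b"] F3_strict_mono[OF assms(1,2), of "eta a b" x] assms
    by (cases x "eta a b" rule: linorder_cases) auto
qed

lemma eta_pos:
  assumes "0 < a" "0 < b"
  shows "0 < eta a b"
  using theI'[OF F3_unique_zero[OF assms]] by (simp add: eta_def)

section \<open>The equation with abstract coefficients\<close>

text \<open>A positive zero lies below \<open>f 0\<close> in value by monotonicity; conversely the
  intermediate value theorem applies between \<open>0\<close> and \<open>v\<close>.\<close>

lemma strict_decreasing_unique_zero_iff:
  fixes f :: "real \<Rightarrow> real"
  assumes cont: "continuous_on {0..} f"
    and dec: "\<And>x y. 0 \<le> x \<Longrightarrow> x < y \<Longrightarrow> f y < f x"
    and neg: "0 \<le> v" "f v < 0"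
  shows "(\<exists>!x. 0 < x \<and> f x = 0) \<longleftrightarrow> 0 < f 0"
proof
  assume "\<exists>!x. 0 < x \<and> f x = 0"
  then obtain x where "0 < x" "f x = 0"
    by blast
  then show "0 < f 0"
    using dec[of 0 x] by simp
next
  assume pos: "0 < f 0"
  have "continuous_on {0..v} f"
    using cont by (rule continuous_on_subset) auto
  then obtain x where x: "0 \<le> x" "f x = 0"
    using IVT2'[of f v 0 0] pos neg by auto
  then have "0 < x"
    using pos by (cases "x = 0") auto
  moreover have "y = z" if "0 < y \<and> f y = 0" "0 < z \<and> f z = 0" for y z
    using that dec[of y z] dec[of z y] by (cases y z rule: linorder_cases) auto
  ultimately show "\<exists>!x. 0 < x \<and> f x = 0"
    using x by blast
qed

text \<open>\<open>s\<close> is the shift added to \<open>erf\<close> and \<open>q\<close> is the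
  square root of \<alpha>12. Since \<open>s > 0\<close>, \<open>f\<close> is continuous up to 0.
  \<open>W\<close> and \<open>G\<close> increase, so each of the three terms of \<open>f\<close>
  decreases.\<close>

lemma erf_equation_unique_zero_iff:
  fixes s A B q g m :: real
  assumes "0 < s" "0 < A" "0 < B" "0 < q" "0 < g" "0 < m"
  defines "W \<equiv> \<lambda>x. x + g * exp (x\<^sup>2) * (erf x + s)"
    and "G \<equiv> \<lambda>x. x + m * exp (x\<^sup>2) * (erf x + s)"
  defines "f \<equiv> \<lambda>x. exp (- x\<^sup>2) / (erf x + s)
      - A * (exp (- (q * W x)\<^sup>2) / erfc (q * W x)) - B * G x"
  shows "(\<exists>!x. 0 < x \<and> f x = 0) \<longleftrightarrow> 0 < f 0"
proof -
  have p: "0 < erf x + s" if "0 \<le> x" for x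
    using erf_nonneg[OF that] assms by simp
  have E: "exp (x\<^sup>2) * (erf x + s) < exp (y\<^sup>2) * (erf y + s)" if "0 \<le> x" "x < y" for x y
    using that p[of x] p[of y] erf_strict_mono[of x y]
    by (intro mult_strict_mono) (auto simp: power_strict_mono)
  have W: "W x < W y" and G: "G x < G y" if "0 \<le> x" "x < y" for x y
    unfolding W_def G_def mult.assoc using that E[OF that] assms
    by (auto intro!: add_strict_mono mult_strict_left_mono)
  have Wn: "0 \<le> W x" if "0 \<le> x" for x
    using p[OF that] that assms by (simp add: W_def)
  show ?thesis
  proof (rule strict_decreasing_unique_zero_iff)
    have c: "continuous_on {0..} (\<lambda>x. erfc (q * W x))"
      unfolding W_def by (intro continuous_on_compose2[OF continuous_on_erfc[of UNIV]] continuous_intros) auto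
    show "continuous_on {0..} f"
      unfolding f_def G_def using c p erfc_pos unfolding W_def
      by (intro continuous_intros) (auto simp: less_imp_neq[symmetric])
  next
    fix x y :: real assume xy: "0 \<le> x" "x < y"
    have "exp (- y\<^sup>2) / (erf y + s) < exp (- x\<^sup>2) / (erf x + s)"
      using xy p[of x] p[of y] erf_strict_mono[of x y]
      by (intro frac_less) (auto simp: power_strict_mono power_mono)
    moreover have "A * (exp (- (q * W x)\<^sup>2) / erfc (q * W x)) < A * (exp (- (q * W y)\<^sup>2) / erfc (q * W y))"
      using assms W[OF xy] Wn[OF xy(1)]
      by (intro mult_strict_left_mono exp_div_erfc_strict_mono) auto
    moreover have "B * G x < B * G y"
      using assms G[OF xy] by (intro mult_strict_left_mono) auto
    ultimately show "f y < f x"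
      by (simp add: f_def)
  next
    \<comment> \<open>Chosen so that \<open>B * v = 1 / s\<close>, the bound on the first term; the
      \<open>erfc\<close> term then makes \<open>f v\<close> strictly negative.\<close>
    define v where "v = 1 / (s * B)"
    show v: "0 \<le> v"
      using assms by (simp add: v_def)
    have "exp (- v\<^sup>2) / (erf v + s) \<le> 1 / s"
      using assms erf_nonneg[OF v] by (intro frac_le) auto
    moreover have "B * v \<le> B * G v"
      using assms p[OF v] by (simp add: G_def)
    moreover have "1 / s = B * v"
      using assms by (simp add: v_def)
    moreover have "0 < A * (exp (- (q * W v)\<^sup>2) / erfc (q * W v))"
      using assms by (simp add: erfc_pos)
    ultimately show "f v < 0"
      unfolding f_def by linarith
  qed
qed

theorem theorem2p2:
  fixes \<rho> k\<^sub>1 k\<^sub>2 c\<^sub>1 c\<^sub>2 l \<gamma> \<theta>\<^sub>0 D h\<^sub>0 \<epsilon> :: real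
  assumes "\<rho> > 0" and "k\<^sub>1 > 0" and "k\<^sub>2 > 0" and "c\<^sub>1 > 0" and "c\<^sub>2 > 0" and "l > 0"
    and "\<gamma> > 0" and "\<theta>\<^sub>0 > 0" and "D > 0" and "h\<^sub>0 > 0" and "0 < \<epsilon>" and "\<epsilon> < 1"
  shows "(\<exists>!x. x > 0 \<and> F3 (\<gamma> * k\<^sub>1 / (\<theta>\<^sub>0 * k\<^sub>2)) ((1 - \<epsilon>) * l / (\<theta>\<^sub>0 * c\<^sub>2)) x = 0) \<and>
    ((\<exists>!x. x > 0 \<and>
        F_fun \<rho> k\<^sub>1 k\<^sub>2 c\<^sub>1 c\<^sub>2 \<gamma> \<theta>\<^sub>0 D h\<^sub>0 x
          = l * sqrt pi / (D * c\<^sub>1) * G_fun \<rho> k\<^sub>1 c\<^sub>1 \<gamma> D h\<^sub>0 \<epsilon> x)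
      \<longleftrightarrow> h\<^sub>0 > h0_star \<rho> k\<^sub>1 k\<^sub>2 c\<^sub>2 l \<gamma> \<theta>\<^sub>0 D \<epsilon>)"
proof -
  define a where "a = \<gamma> * k\<^sub>1 / (\<theta>\<^sub>0 * k\<^sub>2)"
  define b where "b = (1 - \<epsilon>) * l / (\<theta>\<^sub>0 * c\<^sub>2)"
  define \<alpha>\<^sub>1 where "\<alpha>\<^sub>1 = diffusivity \<rho> k\<^sub>1 c\<^sub>1"
  define \<alpha>\<^sub>2 where "\<alpha>\<^sub>2 = diffusivity \<rho> k\<^sub>2 c\<^sub>2"
  define s where "s = k\<^sub>1 / (h\<^sub>0 * sqrt (\<alpha>\<^sub>1 * pi))"
  define A where "A = \<theta>\<^sub>0 * sqrt (k\<^sub>2 * c\<^sub>2) / (D * sqrt (k\<^sub>1 * c\<^sub>1))"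
  define B where "B = l * sqrt pi / (D * c\<^sub>1)"
  define q where "q = sqrt (\<alpha>\<^sub>1 / \<alpha>\<^sub>2)"
  define g where "g = \<gamma> * sqrt pi / (2 * D)"
  define m where "m = (1 - \<epsilon>) * \<gamma> * sqrt pi / (2 * D)"
  define y where "y = \<gamma> * k\<^sub>1 / (2 * D * h\<^sub>0 * sqrt \<alpha>\<^sub>2)"
  define f where "f x = exp (- x\<^sup>2) / (erf x + s)
      - A * (exp (- (q * (x + g * exp (x\<^sup>2) * (erf x + s)))\<^sup>2) / erfc (q * (x + g * exp (x\<^sup>2) * (erf x + s))))
      - B * (x + m * exp (x\<^sup>2) * (erf x + s))" for x
  have \<alpha>: "0 < \<alpha>\<^sub>1" "0 < \<alpha>\<^sub>2"
    using assms by (auto simp: \<alpha>\<^sub>1_def \<alpha>\<^sub>2_def diffusivity_def)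
  have pos: "0 < a" "0 < b" "0 < s" "0 < A" "0 < B" "0 < q" "0 < g" "0 < m" "0 < y"
    using assms \<alpha> by (auto simp: a_def b_def s_def A_def B_def q_def g_def m_def y_def)
  \<comment> \<open>Moves \<alpha>12 inside the square, so that both \<open>exp\<close> and
    \<open>erfc\<close> take the argument \<open>q * W x\<close>.\<close>
  have "q\<^sup>2 = \<alpha>\<^sub>1 / \<alpha>\<^sub>2"
    using \<alpha> by (simp add: q_def)
  then have feq: "F_fun \<rho> k\<^sub>1 k\<^sub>2 c\<^sub>1 c\<^sub>2 \<gamma> \<theta>\<^sub>0 D h\<^sub>0 x = B * G_fun \<rho> k\<^sub>1 c\<^sub>1 \<gamma> D h\<^sub>0 \<epsilon> x \<longleftrightarrow> f x = 0" for x
    by (auto simp: F_fun_def G_fun_def W_fun_def erf_shift_def f_def Let_def power_mult_distrib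
        s_def A_def q_def g_def m_def \<alpha>\<^sub>1_def \<alpha>\<^sub>2_def)
  \<comment> \<open>Thus \<open>y\<close> is \<open>q\<close> times the value of \<open>W\<close> at
    0, the argument of \<open>erfc\<close> in \<open>f 0\<close>.\<close>
  have y: "y = q * g * s"
    using assms \<alpha> by (simp add: y_def q_def g_def s_def real_sqrt_mult real_sqrt_divide field_simps)
  have qq: "q = sqrt (k\<^sub>1 * c\<^sub>2 / (k\<^sub>2 * c\<^sub>1))"
    using assms by (simp add: q_def \<alpha>\<^sub>1_def \<alpha>\<^sub>2_def diffusivity_def field_simps)
  \<comment> \<open>Both sides are nonnegative, so comparing squares suffices.\<close>
  have "q * sqrt (k\<^sub>1 * c\<^sub>1) * k\<^sub>2 = k\<^sub>1 * sqrt (k\<^sub>2 * c\<^sub>2)"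
    by (rule power2_eq_imp_eq) (use assms in \<open>simp_all add: qq field_simps power2_eq_square\<close>)
  then have "2 * (q * g) = A * a * sqrt pi"
    using assms by (simp add: g_def A_def a_def field_simps)
  \<comment> \<open>Facts \<open>1\<close> and \<open>2\<close> extract the factor \<open>A\<close>
    from the outer terms of \<open>f 0\<close>, matching them with the \<open>1 / x\<close> and
    linear terms of \<open>F3\<close>.\<close>
  then have 1: "1 / s = A * (a * sqrt pi / 2 * (1 / y))"
    using pos by (simp add: y field_simps)
  have "q * sqrt (k\<^sub>2 * c\<^sub>2) * c\<^sub>1 = c\<^sub>2 * sqrt (k\<^sub>1 * c\<^sub>1)"
    by (rule power2_eq_imp_eq) (use assms in \<open>simp_all add: qq field_simps power2_eq_square\<close>)
  then have "B = A * (l / (\<theta>\<^sub>0 * c\<^sub>2)) * sqrt pi * q"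
    using assms by (simp add: B_def A_def field_simps)
  moreover have "m = (1 - \<epsilon>) * g" "b = (1 - \<epsilon>) * (l / (\<theta>\<^sub>0 * c\<^sub>2))"
    by (simp_all add: m_def g_def b_def)
  ultimately have 2: "B * (m * s) = A * (b * sqrt pi * y)"
    by (simp add: y)
  have "f 0 = 1 / s - A * (exp (- y\<^sup>2) / erfc y) - B * (m * s)"
    by (simp add: f_def y mult.assoc)
  also have "\<dots> = - (A * F3 a b y)"
    unfolding 1 2 F3_def by (simp only: distrib_left right_diff_distrib)
  finally have "0 < f 0 \<longleftrightarrow> F3 a b y < 0"
    using pos by (simp add: mult_less_0_iff)
  also have "\<dots> \<longleftrightarrow> y < eta a b"
    using pos by (intro F3_neg_iff_less_eta)
  \<comment> \<open>\<open>y\<close> is inversely proportional to \<open>h\<^sub>0\<close>, so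
    \<open>h\<^sub>0\<close> and \<open>eta a b\<close> trade places.\<close>
  also have "\<dots> \<longleftrightarrow> \<gamma> * k\<^sub>1 / (2 * D * eta a b * sqrt \<alpha>\<^sub>2) < h\<^sub>0"
    using eta_pos[OF pos(1,2)] assms \<alpha> by (simp add: y_def field_simps)
  finally have "0 < f 0 \<longleftrightarrow> h0_star \<rho> k\<^sub>1 k\<^sub>2 c\<^sub>2 l \<gamma> \<theta>\<^sub>0 D \<epsilon> < h\<^sub>0"
    by (simp add: h0_star_def a_def b_def \<alpha>\<^sub>2_def)
  moreover have "(\<exists>!x. 0 < x \<and> f x = 0) \<longleftrightarrow> 0 < f 0"
    unfolding f_def using pos by (intro erf_equation_unique_zero_iff)
  ultimately show ?thesis
    using F3_unique_zero[OF pos(1,2)]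
    unfolding B_def[symmetric] feq a_def[symmetric] b_def[symmetric] by simp
qed

end
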